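(* Assume $\Bbbk$ is an algebraically closed field of characteristic $p>0$, let $\mathbb{G}_a=(\Bbbk,+)$, and for $n\ge1$ let $V_n=\Bbbk^3$ be the $\mathbb{G}_a$-module given by the representation $$\mathbb{G}_a\to\operatorname{GL}_3(\Bbbk),\qquad t\mapsto\begin{pmatrix}1&0&0\\-t&1&0\\-t^{p^n}&0&1\end{pmatrix}.$$ Write $\Bbbk[V_n]=\Bbbk[x_0,x_1,x_2]$, where $x_0,x_1,x_2$ is the basis of $V_n^*$ dual to the standard basis of $\Bbbk^3$. Then $$\Bbbk[V_n]^{\mathbb{G}_a}=\Bbbk[x_0,\;x_2x_0^{p^n-1}-x_1^{p^n}]\quad\text{and}\quad \delta(\mathbb{G}_a,V_n)=\sigma(\mathbb{G}_a,V_n)=p^n.$$ Consequently, $\delta(\mathbb{G}_a)=\sigma(\mathbb{G}_a)=\infty$.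
   Context: For a linear algebraic group $G$ over $\Bbbk$, a $G$-module is a finite-dimensional rational representation $V$ of $G$ over $\Bbbk$. $\Bbbk[V]\cong S(V^* )$ is the ring of polynomial functions on $V$, with $G$-action $(g\cdot f)(v)=f(g^{-1}v)$ and invariant ring $\Bbbk[V]^G$, graded by degree. $\Bbbk[V]^G_{\le d}$ is the set of invariants of degree at most $d$. For $S\subseteq \Bbbk[V]$, $S_+$ is the set of elements of $S$ with constant term zero. The nullcone $\mathcal{N}_{G,V}\subseteq V$ is the common zero set of $\Bbbk[V]^G_+$. A subset $S\subseteq\Bbbk[V]^G$ is a $\delta$-set (resp. $\sigma$-set) if for every $v\in V^G\setminus\mathcal{N}_{G,V}$ (resp. $v\in V\setminus\mathcal{N}_{G,V}$) there is $f\in S_+$ with $f(v)\neq 0$. Then $\delta(G,V)$ (resp. $\sigma(G,V)$) is the minimal $d\ge0$ such that $\Bbbk[V]^G_{\le d}$ is a $\delta$-set (resp. $\sigma$-set), and $\delta(G)$ (resp. $\sigma(G)$) is the supremum of $\delta(G,V)$ (resp. $\sigma(G,V)$) over all $G$-modules $V$ (equal to $\infty$ if unbounded). *)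

theory Defs
  imports
    "HOL-Computational_Algebra.Computational_Algebra"
    "HOL-Library.Extended_Nat"
    "HOL-Library.FuncSet"
    "Jordan_Normal_Form.Matrix"
begin

text \<open>
  A linear algebraic group over \<open>'k\<close> is represented by its group of \<open>'k\<close>-points together with its
  coordinate ring, i.e. the set of regular functions on the points.
\<close>

record ('g, 'k) alg_group = "'g monoid" +
  regular_funs :: "('g \<Rightarrow> 'k) set"

definition additive_group :: "('k::field, 'k) alg_group" where
  "additive_group =
     \<lparr>carrier = UNIV, monoid.mult = (+), one = 0, regular_funs = range poly\<rparr>"

abbreviation GL :: "'k::field itself \<Rightarrow> nat \<Rightarrow> 'k mat monoid" where
  "GL ty n \<equiv> units_of (ring_mat ty n ())"

text \<open>
  A \<open>G\<close>-module of dimension \<open>n\<close> is given, after a choice of basis, by a rational representation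
  \<open>\<rho>\<close> on the space of column vectors \<open>carrier_vec n\<close>, so it is encoded as the pair \<open>(n, \<rho>)\<close>.
\<close>

definition rational_rep ::
  "('g, 'k::field) alg_group \<Rightarrow> nat \<Rightarrow> ('g \<Rightarrow> 'k mat) \<Rightarrow> bool" where
  "rational_rep G n \<rho> \<longleftrightarrow>
     \<rho> \<in> hom G (GL TYPE('k) n) \<and>
     (\<forall>i<n. \<forall>j<n. \<exists>r\<in>regular_funs G. \<forall>g\<in>carrier G. \<rho> g $$ (i, j) = r g)"

text \<open>
  The \<open>'k\<close>-algebra \<open>'k[S]\<close> generated by a set \<open>S\<close> of functions on \<open>X\<close>.  Functions on \<open>X\<close> are
  extensional (\<open>undefined\<close> outside \<open>X\<close>), so that equality of functions on \<open>X\<close> is HOL equality.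
\<close>

inductive_set generated_algebra :: "'v set \<Rightarrow> ('v \<Rightarrow> 'k::field) set \<Rightarrow> ('v \<Rightarrow> 'k) set"
  for X :: "'v set" and S :: "('v \<Rightarrow> 'k) set" where
  const: "(\<lambda>v\<in>X. c) \<in> generated_algebra X S"
| gen: "f \<in> S \<Longrightarrow> f \<in> generated_algebra X S"
| add: "\<lbrakk>f \<in> generated_algebra X S; h \<in> generated_algebra X S\<rbrakk>
    \<Longrightarrow> (\<lambda>v\<in>X. f v + h v) \<in> generated_algebra X S"
| mult: "\<lbrakk>f \<in> generated_algebra X S; h \<in> generated_algebra X S\<rbrakk>
    \<Longrightarrow> (\<lambda>v\<in>X. f v * h v) \<in> generated_algebra X S"

definition coord :: "nat \<Rightarrow> nat \<Rightarrow> 'k::field vec \<Rightarrow> 'k" where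
  "coord n i = (\<lambda>v\<in>carrier_vec n. v $ i)"

definition poly_funs :: "nat \<Rightarrow> ('k::field vec \<Rightarrow> 'k) set" where
  "poly_funs n = generated_algebra (carrier_vec n) (coord n ` {..<n})"

text \<open>
  \<open>f\<close> is a linear combination of monomials \<open>x\<^sub>0\<^sup>e\<^sup>0 \<cdots> x\<^sub>n\<^sub>-\<^sub>1\<^sup>e\<^sup>n\<^sup>-\<^sup>1\<close> of total degree at most \<open>d\<close>;
  the exponent vectors \<open>e\<close> range over a finite set.  Over an infinite field a polynomial function
  has unique coefficients, so this is the usual degree (the zero function has every degree bound).
\<close>

definition degree_le :: "nat \<Rightarrow> nat \<Rightarrow> ('k::field vec \<Rightarrow> 'k) \<Rightarrow> bool" where
  "degree_le n d f \<longleftrightarrow>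
     (\<exists>c. \<forall>v\<in>carrier_vec n.
        f v = (\<Sum>e | e \<in> {..<n} \<rightarrow>\<^sub>E {..d} \<and> (\<Sum>i<n. e i) \<le> d. c e * (\<Prod>i<n. v $ i ^ e i)))"

definition act_fun ::
  "('g, 'k::field) alg_group \<Rightarrow> nat \<Rightarrow> ('g \<Rightarrow> 'k mat) \<Rightarrow> 'g \<Rightarrow> ('k vec \<Rightarrow> 'k) \<Rightarrow> 'k vec \<Rightarrow> 'k" where
  "act_fun G n \<rho> g f = (\<lambda>v\<in>carrier_vec n. f (\<rho> (inv\<^bsub>G\<^esub> g) *\<^sub>v v))"

definition invariant_ring ::
  "('g, 'k::field) alg_group \<Rightarrow> nat \<Rightarrow> ('g \<Rightarrow> 'k mat) \<Rightarrow> ('k vec \<Rightarrow> 'k) set" where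
  "invariant_ring G n \<rho> = {f \<in> poly_funs n. \<forall>g\<in>carrier G. act_fun G n \<rho> g f = f}"

definition invariants_le ::
  "('g, 'k::field) alg_group \<Rightarrow> nat \<Rightarrow> ('g \<Rightarrow> 'k mat) \<Rightarrow> nat \<Rightarrow> ('k vec \<Rightarrow> 'k) set" where
  "invariants_le G n \<rho> d = {f \<in> invariant_ring G n \<rho>. degree_le n d f}"

text \<open>The constant term of a polynomial function is its value at the origin.\<close>

definition plus_part :: "nat \<Rightarrow> ('k::field vec \<Rightarrow> 'k) set \<Rightarrow> ('k vec \<Rightarrow> 'k) set" where
  "plus_part n S = {f \<in> S. f (0\<^sub>v n) = 0}"

definition fixed_points ::
  "('g, 'k::field) alg_group \<Rightarrow> nat \<Rightarrow> ('g \<Rightarrow> 'k mat) \<Rightarrow> 'k vec set" where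
  "fixed_points G n \<rho> = {v \<in> carrier_vec n. \<forall>g\<in>carrier G. \<rho> g *\<^sub>v v = v}"

definition nullcone ::
  "('g, 'k::field) alg_group \<Rightarrow> nat \<Rightarrow> ('g \<Rightarrow> 'k mat) \<Rightarrow> 'k vec set" where
  "nullcone G n \<rho> =
     {v \<in> carrier_vec n. \<forall>f\<in>plus_part n (invariant_ring G n \<rho>). f v = 0}"

definition delta_set ::
  "('g, 'k::field) alg_group \<Rightarrow> nat \<Rightarrow> ('g \<Rightarrow> 'k mat) \<Rightarrow> ('k vec \<Rightarrow> 'k) set \<Rightarrow> bool" where
  "delta_set G n \<rho> S \<longleftrightarrow> S \<subseteq> invariant_ring G n \<rho> \<and>
     (\<forall>v\<in>fixed_points G n \<rho> - nullcone G n \<rho>. \<exists>f\<in>plus_part n S. f v \<noteq> 0)"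

definition sigma_set ::
  "('g, 'k::field) alg_group \<Rightarrow> nat \<Rightarrow> ('g \<Rightarrow> 'k mat) \<Rightarrow> ('k vec \<Rightarrow> 'k) set \<Rightarrow> bool" where
  "sigma_set G n \<rho> S \<longleftrightarrow> S \<subseteq> invariant_ring G n \<rho> \<and>
     (\<forall>v\<in>carrier_vec n - nullcone G n \<rho>. \<exists>f\<in>plus_part n S. f v \<noteq> 0)"

text \<open>The minimum exists, since ideals of the polynomial ring are finitely generated.\<close>

definition delta ::
  "('g, 'k::field) alg_group \<Rightarrow> nat \<Rightarrow> ('g \<Rightarrow> 'k mat) \<Rightarrow> nat" where
  "delta G n \<rho> = (LEAST d. delta_set G n \<rho> (invariants_le G n \<rho> d))"

definition sigma ::
  "('g, 'k::field) alg_group \<Rightarrow> nat \<Rightarrow> ('g \<Rightarrow> 'k mat) \<Rightarrow> nat" where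
  "sigma G n \<rho> = (LEAST d. sigma_set G n \<rho> (invariants_le G n \<rho> d))"

definition delta_group :: "('g, 'k::field) alg_group \<Rightarrow> enat" where
  "delta_group G = (SUP (n, \<rho>)\<in>{(n, \<rho>). rational_rep G n \<rho>}. enat (delta G n \<rho>))"

definition sigma_group :: "('g, 'k::field) alg_group \<Rightarrow> enat" where
  "sigma_group G = (SUP (n, \<rho>)\<in>{(n, \<rho>). rational_rep G n \<rho>}. enat (sigma G n \<rho>))"

definition rep_V :: "nat \<Rightarrow> nat \<Rightarrow> 'k::field \<Rightarrow> 'k mat" where
  "rep_V p n t = mat_of_rows_list 3
     [[1, 0, 0],
      [- t, 1, 0],
      [- (t ^ (p ^ n)), 0, 1]]"

end

theory Submission
  imports Defs
begin

text \<open>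
  Write \<open>q = p\<^sup>n\<close> and \<open>u = x\<^sub>2 x\<^sub>0\<^sup>q\<^sup>-\<^sup>1 - x\<^sub>1\<^sup>q\<close>.  Where \<open>x\<^sub>0 \<noteq> 0\<close>, moving a point into the slice
  \<open>x\<^sub>1 = 0\<close> writes an invariant \<open>f\<close> as a polynomial in \<open>x\<^sub>0\<close> and \<open>u\<close> divided by a power of \<open>x\<^sub>0\<close>.
  The power of \<open>x\<^sub>0\<close> can be cancelled one factor at a time: on \<open>x\<^sub>0 = 0\<close> the function \<open>u = - x\<^sub>1\<^sup>q\<close>
  takes all values, so a polynomial in \<open>x\<^sub>0, u\<close> that vanishes there is divisible by \<open>x\<^sub>0\<close>.
  Hence \<open>x\<^sub>0\<close> and \<open>u\<close>, of degrees \<open>1\<close> and \<open>q\<close>, generate the invariants and cut out the nullcone.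
  On the line of fixed points through \<open>(0, 1, 0)\<close> every invariant is a polynomial in the \<open>q\<close>-th
  power of the coordinate, so an invariant of degree less than \<open>q\<close> is constant there.
\<close>

lemma infinite_UNIV_alg_closed: "infinite (UNIV :: 'k::alg_closed_field set)"
proof
  assume fin: "finite (UNIV :: 'k set)"
  define P where "P = (\<Prod>a\<in>(UNIV::'k set). [:- a, 1:]) + 1"
  have "degree (\<Prod>a\<in>(UNIV::'k set). [:- a, 1:]) = card (UNIV :: 'k set)"
    by (subst degree_prod_eq_sum_degree) auto
  moreover have "card (UNIV :: 'k set) > 0"
    using fin by (simp add: card_gt_0_iff)
  ultimately have "degree P > 0"
    unfolding P_def by (subst degree_add_eq_left) auto
  then obtain x where "poly P x = 0"
    using alg_closed_imp_poly_has_root by blast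
  moreover have "poly P x = 1"
    using fin by (auto simp: P_def poly_prod intro!: prod_zero)
  ultimately show False by simp
qed

lemma poly_eqI_infinite:
  fixes P Q :: "'k::idom poly"
  assumes "infinite (UNIV :: 'k set)" "finite A" "\<And>x. x \<notin> A \<Longrightarrow> poly P x = poly Q x"
  shows "P = Q"
proof (rule ccontr)
  assume "P \<noteq> Q"
  then have "finite {x. poly (P - Q) x = 0}"
    by (intro poly_roots_finite) auto
  moreover have "- A \<subseteq> {x. poly (P - Q) x = 0}"
    using assms(3) by auto
  ultimately have "finite (- A)"
    by (rule finite_subset[rotated])
  with assms(1,2) show False
    by (metis Compl_eq_Diff_UNIV Diff_infinite_finite)
qed

definition poly2 :: "'k::comm_ring_1 poly poly \<Rightarrow> 'k \<Rightarrow> 'k \<Rightarrow> 'k" where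
  "poly2 h a s = poly (poly h [:a:]) s"

lemma poly2_0 [simp]: "poly2 0 a s = 0"
  by (simp add: poly2_def)

lemma poly2_pCons [simp]: "poly2 (pCons r h) a s = poly r s + a * poly2 h a s"
  by (simp add: poly2_def)

lemma poly2_add [simp]: "poly2 (g + h) a s = poly2 g a s + poly2 h a s"
  by (simp add: poly2_def)

lemma poly2_mult [simp]: "poly2 (g * h) a s = poly2 g a s * poly2 h a s"
  by (simp add: poly2_def)

lemma poly2_monom [simp]: "poly2 (monom [:1:] N) a s = a ^ N"
  by (simp add: poly2_def poly_monom)

lemma poly2_along_curve:
  "\<exists>P. \<forall>x. poly2 h (poly A x) (poly B x) = poly P x"
proof (induction h)
  case (pCons r h)
  then obtain P where "\<forall>x. poly2 h (poly A x) (poly B x) = poly P x" by blast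
  then show ?case
    by (intro exI[of _ "pcompose r B + A * P"]) (simp add: poly_pcompose)
qed (auto intro: exI[of _ 0])

subsection \<open>Algebras of functions\<close>

lemma generated_algebra_extensional:
  assumes "S \<subseteq> extensional X" "f \<in> generated_algebra X S"
  shows "f \<in> extensional X"
  using assms(2) by induction (use assms(1) in \<open>auto simp del: restrict_apply\<close>)

lemma generated_algebra_add:
  assumes "(\<lambda>v\<in>X. f v) \<in> generated_algebra X S" "(\<lambda>v\<in>X. g v) \<in> generated_algebra X S"
  shows "(\<lambda>v\<in>X. f v + g v) \<in> generated_algebra X S"
  using generated_algebra.add[OF assms] by (simp cong: restrict_cong)

lemma generated_algebra_mult:
  assumes "(\<lambda>v\<in>X. f v) \<in> generated_algebra X S" "(\<lambda>v\<in>X. g v) \<in> generated_algebra X S"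
  shows "(\<lambda>v\<in>X. f v * g v) \<in> generated_algebra X S"
  using generated_algebra.mult[OF assms] by (simp cong: restrict_cong)

lemma generated_algebra_diff:
  assumes "(\<lambda>v\<in>X. f v) \<in> generated_algebra X S" "(\<lambda>v\<in>X. g v) \<in> generated_algebra X S"
  shows "(\<lambda>v\<in>X. f v - g v) \<in> generated_algebra X S"
  using generated_algebra_add[OF assms(1)
      generated_algebra_mult[OF generated_algebra.const[of "-1"] assms(2)]]
  by simp

lemma generated_algebra_power:
  assumes "(\<lambda>v\<in>X. f v) \<in> generated_algebra X S"
  shows "(\<lambda>v\<in>X. f v ^ k) \<in> generated_algebra X S"
proof (induction k)
  case 0
  show ?case unfolding power_0 by (rule generated_algebra.const)
next
  case (Suc k)
  show ?case unfolding power_Suc by (rule generated_algebra_mult[OF assms Suc])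
qed

lemma generated_algebra_poly:
  assumes "(\<lambda>v\<in>X. f v) \<in> generated_algebra X S"
  shows "(\<lambda>v\<in>X. poly r (f v)) \<in> generated_algebra X S"
proof (induction r)
  case 0
  show ?case unfolding poly_0 by (rule generated_algebra.const)
next
  case (pCons c r)
  show ?case
    unfolding poly_pCons
    by (rule generated_algebra_add[OF generated_algebra.const
          generated_algebra_mult[OF assms pCons.IH]])
qed

lemma generated_algebra_poly2:
  assumes "(\<lambda>v\<in>X. f v) \<in> generated_algebra X S" "(\<lambda>v\<in>X. g v) \<in> generated_algebra X S"
  shows "(\<lambda>v\<in>X. poly2 h (f v) (g v)) \<in> generated_algebra X S"
proof (induction h)
  case 0
  show ?case unfolding poly2_0 by (rule generated_algebra.const)
next
  case (pCons r h)
  show ?case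
    unfolding poly2_pCons
    by (rule generated_algebra_add[OF generated_algebra_poly[OF assms(2)]
          generated_algebra_mult[OF assms(1) pCons.IH]])
qed

lemma coord_in_poly_funs: "i < n \<Longrightarrow> coord n i \<in> poly_funs n"
  by (auto simp: poly_funs_def intro: generated_algebra.gen)

lemma poly_funs_extensional: "f \<in> poly_funs n \<Longrightarrow> f \<in> extensional (carrier_vec n)"
  unfolding poly_funs_def
  by (erule generated_algebra_extensional[rotated]) (auto simp: coord_def)

lemma invariant_ring_iff:
  "f \<in> invariant_ring G n \<rho> \<longleftrightarrow> f \<in> poly_funs n \<and>
    (\<forall>g\<in>carrier G. \<forall>v\<in>carrier_vec n. f (\<rho> (inv\<^bsub>G\<^esub> g) *\<^sub>v v) = f v)"
proof -
  have "act_fun G n \<rho> g f = f \<longleftrightarrow> (\<forall>v\<in>carrier_vec n. f (\<rho> (inv\<^bsub>G\<^esub> g) *\<^sub>v v) = f v)"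
    if "f \<in> poly_funs n" for g
    unfolding act_fun_def fun_eq_iff restrict_def
    using poly_funs_extensional[OF that] by (auto simp only: extensional_def mem_Collect_eq split: if_splits)
  then show ?thesis
    by (auto simp: invariant_ring_def)
qed

lemma invariant_ring_subalgebra:
  assumes "S \<subseteq> invariant_ring G n \<rho>"
    and "\<And>g. g \<in> carrier G \<Longrightarrow> \<rho> (inv\<^bsub>G\<^esub> g) \<in> carrier_mat n n"
  shows "generated_algebra (carrier_vec n) S \<subseteq> invariant_ring G n \<rho>"
proof
  fix f assume "f \<in> generated_algebra (carrier_vec n) S"
  moreover have carrier: "\<rho> (inv\<^bsub>G\<^esub> g) *\<^sub>v v \<in> carrier_vec n"
    if "g \<in> carrier G" "v \<in> carrier_vec n" for g v
    using assms(2)[OF that(1)] that(2) by simp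
  ultimately show "f \<in> invariant_ring G n \<rho>"
  proof induction
    case (gen f)
    then show ?case using assms(1) by auto
  next
    case (const c)
    then show ?case
      by (auto simp: invariant_ring_iff poly_funs_def restrict_apply' simp del: restrict_apply
          intro: generated_algebra.const)
  next
    case (add f h)
    then show ?case
      by (auto simp: invariant_ring_iff poly_funs_def restrict_apply' simp del: restrict_apply
          intro: generated_algebra.add)
  next
    case (mult f h)
    then show ?case
      by (auto simp: invariant_ring_iff poly_funs_def restrict_apply' simp del: restrict_apply
          intro: generated_algebra.mult)
  qed
qed

lemma sigma_set_imp_delta_set: "sigma_set G n \<rho> S \<Longrightarrow> delta_set G n \<rho> S"
  by (auto simp: sigma_set_def delta_set_def fixed_points_def)

subsection \<open>Degree bounds\<close>

lemma degree_le_monomial: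
  assumes "\<And>v. v \<in> carrier_vec n \<Longrightarrow> f v = c * (\<Prod>i<n. v $ i ^ e i)" "(\<Sum>i<n. e i) \<le> d"
  shows "degree_le n d f"
proof -
  let ?E = "{e'. e' \<in> {..<n} \<rightarrow>\<^sub>E {..d} \<and> (\<Sum>i<n. e' i) \<le> d}"
  define e' where "e' = (\<lambda>i\<in>{..<n}. e i)"
  have "e i \<le> d" if "i < n" for i
    using member_le_sum[of i "{..<n}" e] that assms(2) by simp
  then have e': "e' \<in> ?E"
    using assms(2) by (auto simp: e'_def)
  have fin: "finite ?E"
    by (rule finite_subset[of _ "{..<n} \<rightarrow>\<^sub>E {..d}"]) (auto intro: finite_PiE)
  show ?thesis
    unfolding degree_le_def
  proof (intro exI ballI)
    fix v :: "'a vec" assume v: "v \<in> carrier_vec n"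
    have "(\<Sum>e''\<in>?E. (if e'' = e' then c else 0) * (\<Prod>i<n. v $ i ^ e'' i))
        = (\<Sum>e''\<in>?E. if e'' = e' then c * (\<Prod>i<n. v $ i ^ e' i) else 0)"
      by (intro sum.cong) auto
    also have "\<dots> = c * (\<Prod>i<n. v $ i ^ e' i)"
      using e' fin by (simp add: sum.delta)
    also have "\<dots> = f v"
      using assms(1)[OF v] by (simp add: e'_def)
    finally show "f v = (\<Sum>e''\<in>?E. (if e'' = e' then c else 0) * (\<Prod>i<n. v $ i ^ e'' i))" ..
  qed
qed

lemma degree_le_add:
  assumes "degree_le n d f" "degree_le n d g"
    "\<And>v. v \<in> carrier_vec n \<Longrightarrow> h v = f v + g v"
  shows "degree_le n d h"
proof -
  let ?E = "{e. e \<in> {..<n} \<rightarrow>\<^sub>E {..d} \<and> (\<Sum>i<n. e i) \<le> d}"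
  from assms(1,2) obtain c c' where
    "\<forall>v\<in>carrier_vec n. f v = (\<Sum>e\<in>?E. c e * (\<Prod>i<n. v $ i ^ e i))"
    "\<forall>v\<in>carrier_vec n. g v = (\<Sum>e\<in>?E. c' e * (\<Prod>i<n. v $ i ^ e i))"
    unfolding degree_le_def by blast
  then show ?thesis
    unfolding degree_le_def
    by (intro exI[of _ "\<lambda>e. c e + c' e"]) (auto simp: assms(3) algebra_simps sum.distrib)
qed

lemma degree_le_on_line:
  fixes f :: "'k::field vec \<Rightarrow> 'k"
  assumes "degree_le n d f" "w \<in> carrier_vec n"
  shows "\<exists>P. degree P \<le> d \<and> (\<forall>s. f (s \<cdot>\<^sub>v w) = poly P s)"
proof -
  let ?E = "{e. e \<in> {..<n} \<rightarrow>\<^sub>E {..d} \<and> (\<Sum>i<n. e i) \<le> d}"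
  from assms(1) obtain c where
    c: "\<forall>v\<in>carrier_vec n. f v = (\<Sum>e\<in>?E. c e * (\<Prod>i<n. v $ i ^ e i))"
    unfolding degree_le_def by blast
  define P where "P = (\<Sum>e\<in>?E. monom (c e * (\<Prod>i<n. w $ i ^ e i)) (\<Sum>i<n. e i))"
  have "degree P \<le> d"
    unfolding P_def
  proof (rule degree_sum_le)
    show "finite ?E"
      by (rule finite_subset[of _ "{..<n} \<rightarrow>\<^sub>E {..d}"]) (auto intro: finite_PiE)
    show "degree (monom (c e * (\<Prod>i<n. w $ i ^ e i)) (\<Sum>i<n. e i)) \<le> d" if "e \<in> ?E" for e
    proof (rule order_trans[OF degree_monom_le])
      show "(\<Sum>i<n. e i) \<le> d" using CollectD[OF that] by (rule conjunct2)
    qed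
  qed
  moreover have "f (s \<cdot>\<^sub>v w) = poly P s" for s
  proof -
    have "f (s \<cdot>\<^sub>v w) = (\<Sum>e\<in>?E. c e * (\<Prod>i<n. (s \<cdot>\<^sub>v w) $ i ^ e i))"
      using assms(2) by (intro bspec[OF c]) simp
    also have "\<dots> = (\<Sum>e\<in>?E. c e * (\<Prod>i<n. w $ i ^ e i) * s ^ (\<Sum>i<n. e i))"
    proof (rule sum.cong[OF refl])
      fix e
      have "(\<Prod>i<n. (s \<cdot>\<^sub>v w) $ i ^ e i) = (\<Prod>i<n. s ^ e i * w $ i ^ e i)"
        using assms(2) by (intro prod.cong) (auto simp: power_mult_distrib)
      then show "c e * (\<Prod>i<n. (s \<cdot>\<^sub>v w) $ i ^ e i) = c e * (\<Prod>i<n. w $ i ^ e i) * s ^ (\<Sum>i<n. e i)"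
        by (simp only: prod.distrib power_sum ac_simps)
    qed
    also have "\<dots> = poly P s"
      by (simp only: P_def poly_sum poly_monom)
    finally show ?thesis .
  qed
  ultimately show ?thesis by blast
qed

subsection \<open>The module\<close>

definition vec3 :: "'a \<Rightarrow> 'a \<Rightarrow> 'a \<Rightarrow> 'a vec" where
  "vec3 a b c = vec_of_list [a, b, c]"

lemma vec3_carrier [simp]: "vec3 a b c \<in> carrier_vec 3"
  by (intro carrier_vecI) (simp add: vec3_def del: vec_of_list_Cons)

lemma dim_vec3 [simp]: "dim_vec (vec3 a b c) = 3"
  by (rule carrier_vecD[OF vec3_carrier])

lemma vec3_index [simp]:
  "vec3 a b c $ 0 = a" "vec3 a b c $ Suc 0 = b" "vec3 a b c $ 2 = c"
  unfolding vec3_def vec_of_list_index by simp_all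

lemma vec3_eqI:
  fixes v :: "'a vec"
  assumes "v \<in> carrier_vec 3" "v $ 0 = a" "v $ Suc 0 = b" "v $ 2 = c"
  shows "v = vec3 a b c"
proof (rule eq_vecI)
  show "dim_vec v = dim_vec (vec3 a b c)"
    unfolding carrier_vecD[OF assms(1)] dim_vec3 ..
  fix i assume "i < dim_vec (vec3 a b c)"
  then have "i < 3"
    unfolding dim_vec3 .
  then have "i = 0 \<or> i = Suc 0 \<or> i = 2" by arith
  then show "v $ i = vec3 a b c $ i"
    using assms(2-4) by (elim disjE) (simp_all only: vec3_index)
qed

lemma vec3_cases:
  assumes "v \<in> carrier_vec 3"
  obtains a b c where "v = vec3 a b c"
  using vec3_eqI[OF assms refl refl refl] by (rule that)

lemma zero_vec3: "0\<^sub>v 3 = vec3 0 0 0"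
  by (rule vec3_eqI) simp_all

lemma smult_vec3: "(s::'k::field) \<cdot>\<^sub>v vec3 a b c = vec3 (s * a) (s * b) (s * c)"
  by (rule vec3_eqI) simp_all

lemma coord_vec3 [simp]:
  "coord 3 0 (vec3 a b c) = a" "coord 3 (Suc 0) (vec3 a b c) = b" "coord 3 2 (vec3 a b c) = c"
  by (simp_all add: coord_def)

lemma rep_V_carrier [simp]: "rep_V p n t \<in> carrier_mat 3 3"
  by (intro carrier_matI) (simp_all add: rep_V_def mat_of_rows_list_def)

lemma rep_V_vec3: "rep_V p n t *\<^sub>v vec3 a b c = vec3 a (b - t * a) (c - t ^ (p ^ n) * a)"
  by (intro vec3_eqI)
    (auto simp: rep_V_def mat_of_rows_list_def mult_mat_vec_def scalar_prod_def vec3_def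
      numeral_2_eq_2 vec_of_list_index)

lemma poly_funs_along_curve:
  assumes "f \<in> poly_funs 3"
  shows "\<exists>P. \<forall>x. f (vec3 (poly A x) (poly B x) (poly C x)) = poly P x"
  using assms unfolding poly_funs_def
proof induction
  case (const c)
  then show ?case by (intro exI[of _ "[:c:]"]) auto
next
  case (gen f)
  then obtain i where i: "i < 3" "f = coord 3 i" by auto
  then have "i = 0 \<or> i = Suc 0 \<or> i = 2" by arith
  then consider "i = 0" | "i = Suc 0" | "i = 2" by blast
  then show ?case
    using i by cases auto
next
  case (add f h)
  then obtain P Q where "\<forall>x. f (vec3 (poly A x) (poly B x) (poly C x)) = poly P x"
    "\<forall>x. h (vec3 (poly A x) (poly B x) (poly C x)) = poly Q x" by blast
  then show ?case by (intro exI[of _ "P + Q"]) simp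
next
  case (mult f h)
  then obtain P Q where "\<forall>x. f (vec3 (poly A x) (poly B x) (poly C x)) = poly P x"
    "\<forall>x. h (vec3 (poly A x) (poly B x) (poly C x)) = poly Q x" by blast
  then show ?case by (intro exI[of _ "P * Q"]) simp
qed

lemma poly_funs_on_slice:
  fixes f :: "'k::field vec \<Rightarrow> 'k"
  assumes "f \<in> poly_funs 3"
  shows "\<exists>N h. \<forall>a s. a \<noteq> 0 \<longrightarrow> a ^ N * f (vec3 a 0 (s / a ^ m)) = poly2 h a s"
  using assms unfolding poly_funs_def
proof induction
  case (const c)
  then show ?case by (intro exI[of _ 0] exI[of _ "[:[:c:]:]"]) auto
next
  case (gen f)
  then obtain i where i: "i < 3" "f = coord 3 i" by auto
  then have "i = 0 \<or> i = Suc 0 \<or> i = 2" by arith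
  then consider "i = 0" | "i = Suc 0" | "i = 2" by blast
  then show ?case
  proof cases
    case 1
    then show ?thesis using i by (intro exI[of _ 0] exI[of _ "[:0, 1:]"]) auto
  next
    case 2
    then show ?thesis using i by (intro exI[of _ 0] exI[of _ 0]) auto
  next
    case 3
    then show ?thesis using i by (intro exI[of _ m] exI[of _ "[:[:0, 1:]:]"]) auto
  qed
next
  case (add f g)
  then obtain N h M k where
    "\<And>a s. a \<noteq> 0 \<Longrightarrow> poly2 h a s = a ^ N * f (vec3 a 0 (s / a ^ m))"
    "\<And>a s. a \<noteq> 0 \<Longrightarrow> poly2 k a s = a ^ M * g (vec3 a 0 (s / a ^ m))" by metis
  then show ?case
    by (intro exI[of _ "N + M"] exI[of _ "monom [:1:] M * h + monom [:1:] N * k"])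
      (simp add: algebra_simps power_add)
next
  case (mult f g)
  then obtain N h M k where
    "\<And>a s. a \<noteq> 0 \<Longrightarrow> poly2 h a s = a ^ N * f (vec3 a 0 (s / a ^ m))"
    "\<And>a s. a \<noteq> 0 \<Longrightarrow> poly2 k a s = a ^ M * g (vec3 a 0 (s / a ^ m))" by metis
  then show ?case
    by (intro exI[of _ "N + M"] exI[of _ "h * k"])
      (simp add: algebra_simps power_add)
qed

lemma cancel_x0_power:
  fixes f :: "'k::alg_closed_field vec \<Rightarrow> 'k"
  assumes f: "f \<in> poly_funs 3" and q: "q > 1"
    and "\<And>a b c. a ^ N * f (vec3 a b c) = poly2 h a (c * a ^ (q - 1) - b ^ q)"
  shows "\<exists>h. \<forall>a b c. f (vec3 a b c) = poly2 h a (c * a ^ (q - 1) - b ^ q)"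
  using assms(3)
proof (induction N arbitrary: h)
  case 0
  then show ?case by auto
next
  case (Suc N)
  obtain r k where h: "h = pCons r k" by (cases h)
  have "poly r s = poly 0 s" for s
  proof -
    obtain b where "b ^ q = - s"
      using nth_root_exists[of q "- s"] q by auto
    then show ?thesis
      using Suc.prems[of 0 b 0] q by (simp add: h)
  qed
  then have r: "r = 0"
    using poly_eqI_infinite[OF infinite_UNIV_alg_closed, of "{}"] by blast
  have "a ^ N * f (vec3 a b c) = poly2 k a (c * a ^ (q - 1) - b ^ q)" for a b c
  proof -
    obtain P where P: "\<And>x. f (vec3 x b c) = poly P x"
      using poly_funs_along_curve[OF f, of "[:0, 1:]" "[:b:]" "[:c:]"] by auto
    obtain Q where Q: "\<And>x. poly2 k x (c * x ^ (q - 1) - b ^ q) = poly Q x"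
      using poly2_along_curve[of k "[:0, 1:]" "monom c (q - 1) - [:b ^ q:]"]
      by (auto simp: poly_monom)
    have "monom 1 N * P = Q"
    proof (rule poly_eqI_infinite[OF infinite_UNIV_alg_closed, of "{0}"])
      fix x :: 'k assume "x \<notin> {0}"
      then show "poly (monom 1 N * P) x = poly Q x"
        using Suc.prems[of x b c] by (simp add: h r poly_monom mult.assoc flip: P Q)
    qed simp
    then have "poly Q a = a ^ N * poly P a"
      by (auto simp: poly_monom)
    then show ?thesis
      by (simp only: P Q)
  qed
  then show ?case by (rule Suc.IH)
qed

lemma inv_additive_group [simp]: "inv\<^bsub>additive_group\<^esub> t = - (t::'k::field)"
  unfolding m_inv_def
proof (rule the_equality)
  fix s assume "s \<in> carrier additive_group \<and> t \<otimes>\<^bsub>additive_group\<^esub> s = \<one>\<^bsub>additive_group\<^esub> \<and>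
    s \<otimes>\<^bsub>additive_group\<^esub> t = \<one>\<^bsub>additive_group\<^esub>"
  then have "s + t = 0" by (simp add: additive_group_def)
  then show "s = - t" by (simp only: eq_neg_iff_add_eq_0)
qed (simp add: additive_group_def)

lemma carrier_additive_group [simp]: "carrier additive_group = UNIV"
  by (simp add: additive_group_def)

definition inv_u :: "nat \<Rightarrow> 'k::field vec \<Rightarrow> 'k" where
  "inv_u q = (\<lambda>v\<in>carrier_vec 3. coord 3 2 v * coord 3 0 v ^ (q - 1) - coord 3 1 v ^ q)"

lemma inv_u_vec3 [simp]: "inv_u q (vec3 a b c) = c * a ^ (q - 1) - b ^ q"
  unfolding inv_u_def restrict_apply'[OF vec3_carrier] One_nat_def coord_vec3 ..

lemma invariant_ring_rep_V_iff:
  "f \<in> invariant_ring additive_group 3 (rep_V p n) \<longleftrightarrow> f \<in> poly_funs 3 \<and>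
    (\<forall>t a b c. f (vec3 a (b - t * a) (c - t ^ (p ^ n) * a)) = f (vec3 a b c))"
proof -
  have "(\<forall>g. \<forall>v\<in>carrier_vec 3. f (rep_V p n (- g) *\<^sub>v v) = f v) \<longleftrightarrow>
      (\<forall>t. \<forall>v\<in>carrier_vec 3. f (rep_V p n t *\<^sub>v v) = f v)"
    by (metis minus_minus)
  also have "\<dots> \<longleftrightarrow> (\<forall>t a b c. f (vec3 a (b - t * a) (c - t ^ (p ^ n) * a)) = f (vec3 a b c))"
    by (metis rep_V_vec3 vec3_carrier vec3_cases)
  finally show ?thesis
    by (simp add: invariant_ring_iff)
qed

lemma poly2_form_of_invariant:
  fixes f :: "'k::alg_closed_field vec \<Rightarrow> 'k"
  assumes "f \<in> invariant_ring additive_group 3 (rep_V p n)" and q: "p ^ n > 1"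
  shows "\<exists>h. \<forall>a b c. f (vec3 a b c) = poly2 h a (c * a ^ (p ^ n - 1) - b ^ (p ^ n))"
proof -
  let ?q = "p ^ n"
  have f: "f \<in> poly_funs 3"
    and inv: "\<And>t a b c. f (vec3 a (b - t * a) (c - t ^ ?q * a)) = f (vec3 a b c)"
    using assms(1) by (auto simp: invariant_ring_rep_V_iff)
  obtain N h where Nh:
    "\<And>a s. a \<noteq> 0 \<Longrightarrow> a ^ N * f (vec3 a 0 (s / a ^ (?q - 1))) = poly2 h a s"
    using poly_funs_on_slice[OF f] by blast
  have off: "a ^ N * f (vec3 a b c) = poly2 h a (c * a ^ (?q - 1) - b ^ ?q)"
    if a: "a \<noteq> 0" for a b c
  proof -
    obtain m where m: "?q = Suc m"
      using q by (cases ?q) auto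
    have "(b / a) ^ ?q * a = b ^ ?q / a ^ m"
      unfolding m power_divide using a by simp
    then have "c - (b / a) ^ ?q * a = (c * a ^ (?q - 1) - b ^ ?q) / a ^ (?q - 1)"
      unfolding m diff_Suc_1 using a by (simp add: diff_divide_distrib)
    then have "f (vec3 a b c) = f (vec3 a 0 ((c * a ^ (?q - 1) - b ^ ?q) / a ^ (?q - 1)))"
      using inv[of a b "b / a" c] a by simp
    with Nh[OF a] show ?thesis by simp
  qed
  have "a ^ Suc N * f (vec3 a b c) = poly2 (pCons 0 h) a (c * a ^ (?q - 1) - b ^ ?q)" for a b c
    using off[of a b c] by (cases "a = 0") auto
  with cancel_x0_power[OF f q] show ?thesis by blast
qed

lemma coord0_invariant: "coord 3 0 \<in> invariant_ring additive_group 3 (rep_V p n)"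
  by (simp add: invariant_ring_rep_V_iff coord_in_poly_funs)

lemma inv_u_poly_fun: "(inv_u q :: 'k::field vec \<Rightarrow> 'k) \<in> poly_funs 3"
proof -
  have "(\<lambda>v\<in>carrier_vec 3. coord 3 i v :: 'k) \<in> generated_algebra (carrier_vec 3) (coord 3 ` {..<3})"
    if "i < 3" for i
    using coord_in_poly_funs[OF that] by (simp add: poly_funs_def coord_def cong: restrict_cong)
  then show ?thesis
    unfolding poly_funs_def inv_u_def
    by (intro generated_algebra_diff generated_algebra_mult generated_algebra_power) auto
qed

lemma rational_rep_V:
  assumes "prime CHAR('k::field)" "p = CHAR('k)"
  shows "rational_rep additive_group 3 (rep_V p n :: 'k \<Rightarrow> 'k mat)"
proof -
  have "(s + t) ^ (p ^ n) = s ^ (p ^ n) + t ^ (p ^ n)" for s t :: 'k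
    by (rule freshmans_dream'[OF assms(1)]) (simp only: assms(2))
  then have mult: "rep_V p n (s + t) = rep_V p n s * rep_V p n t" for s t :: 'k
    unfolding rep_V_def
    by (intro eq_matI) (auto simp: mat_of_rows_list_def scalar_prod_def less_Suc_eq numeral_3_eq_3)
  have q: "p ^ n > 0"
    using assms prime_gt_0_nat by auto
  have one: "rep_V p n (0::'k) = 1\<^sub>m 3"
    using q by (intro eq_matI)
      (auto simp: rep_V_def mat_of_rows_list_def less_Suc_eq numeral_3_eq_3)
  have "rep_V p n t \<in> Units (ring_mat TYPE('k) 3 ())" for t
    unfolding Units_def using mult[of t "- t"] mult[of "- t" t]
    by (auto simp: ring_mat_def one intro!: bexI[of _ "rep_V p n (- t)"])
  then have "rep_V p n \<in> hom additive_group (GL TYPE('k) 3)"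
    by (auto simp: hom_def units_of_def additive_group_def mult ring_mat_def)
  moreover have "\<exists>P. \<forall>t::'k. rep_V p n t $$ (i, j) = poly P t" if "i < 3" "j < 3" for i j
  proof -
    define P :: "'k poly" where "P = [[1, 0, 0], [[:0, -1:], 1, 0], [- monom 1 (p ^ n), 0, 1]] ! i ! j"
    have "rep_V p n t $$ (i, j) = poly P t" for t
      using that by (auto simp: rep_V_def mat_of_rows_list_def P_def less_Suc_eq numeral_3_eq_3
          poly_monom)
    then show ?thesis by blast
  qed
  ultimately show ?thesis
    by (auto simp: rational_rep_def additive_group_def)
qed

lemma inv_u_invariant:
  assumes "prime CHAR('k::field)" "p = CHAR('k)"
  shows "(inv_u (p ^ n) :: 'k vec \<Rightarrow> 'k) \<in> invariant_ring additive_group 3 (rep_V p n)"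
proof -
  let ?q = "p ^ n"
  have q: "?q > 0"
    using assms prime_gt_0_nat by auto
  have pow: "(b - t * a) ^ ?q = b ^ ?q - t ^ ?q * (a ^ (?q - 1) * a)" for a b t :: 'k
  proof -
    have "(b - t * a) ^ ?q + (t * a) ^ ?q = b ^ ?q"
      using freshmans_dream'[OF assms(1), of ?q n "b - t * a" "t * a"] assms(2) by simp
    then show ?thesis
      by (simp only: eq_diff_eq power_mult_distrib power_minus_mult[OF q])
  qed
  have "(c - T * a) * A - (B - T * (A * a)) = c * A - B" for a c A B T :: 'k
    by (simp add: algebra_simps)
  then have "inv_u ?q (vec3 a (b - t * a) (c - t ^ ?q * a)) = inv_u ?q (vec3 a b c)"
    for a b c t :: 'k
    unfolding inv_u_vec3 pow .
  then show ?thesis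
    by (simp only: invariant_ring_rep_V_iff inv_u_poly_fun) simp
qed

lemma invariant_ring_rep_V:
  assumes "prime CHAR('k::alg_closed_field)" "p = CHAR('k)" "n \<ge> 1"
  shows "invariant_ring additive_group 3 (rep_V p n :: 'k \<Rightarrow> 'k mat) =
    generated_algebra (carrier_vec 3) {coord 3 0, inv_u (p ^ n)}" (is "?I = ?A")
proof
  show "?A \<subseteq> ?I"
    using coord0_invariant inv_u_invariant[OF assms(1,2)]
    by (intro invariant_ring_subalgebra) auto
next
  have q: "p ^ n > 1"
    using assms prime_gt_1_nat by (intro one_less_power) auto
  show "?I \<subseteq> ?A"
  proof
    fix f assume f: "f \<in> ?I"
    then obtain h where
      h: "\<And>a b c. f (vec3 a b c) = poly2 h a (c * a ^ (p ^ n - 1) - b ^ (p ^ n))"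
      using poly2_form_of_invariant[OF _ q] by blast
    have ext: "f \<in> extensional (carrier_vec 3)"
      using f poly_funs_extensional by (auto simp: invariant_ring_def)
    have "f = (\<lambda>v\<in>carrier_vec 3. poly2 h (coord 3 0 v) (inv_u (p ^ n) v))"
    proof
      fix v
      show "f v = (\<lambda>v\<in>carrier_vec 3. poly2 h (coord 3 0 v) (inv_u (p ^ n) v)) v"
        using ext by (cases "v \<in> carrier_vec 3")
          (auto elim!: vec3_cases simp: h extensional_def)
    qed
    also have "\<dots> \<in> ?A"
    proof (rule generated_algebra_poly2)
      have "(\<lambda>v\<in>carrier_vec 3. coord 3 0 v) = (coord 3 0 :: 'k vec \<Rightarrow> 'k)"
        "(\<lambda>v\<in>carrier_vec 3. inv_u (p ^ n) v) = (inv_u (p ^ n) :: 'k vec \<Rightarrow> 'k)"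
        by (auto simp: coord_def inv_u_def)
      then show "(\<lambda>v\<in>carrier_vec 3. coord 3 0 v) \<in> ?A"
        "(\<lambda>v\<in>carrier_vec 3. inv_u (p ^ n) v) \<in> ?A"
        by (auto intro: generated_algebra.gen)
    qed
    finally show "f \<in> ?A" .
  qed
qed

lemma degree_le_coord: "i < n \<Longrightarrow> d \<ge> 1 \<Longrightarrow> degree_le n d (coord n i)"
  by (rule degree_le_monomial[of _ _ 1 "\<lambda>j. if j = i then 1 else 0"])
    (auto simp: coord_def if_distrib[of "(^) _"] prod.delta cong: if_cong)

lemma degree_le_inv_u:
  assumes "q \<ge> 1"
  shows "degree_le 3 q (inv_u q :: 'k::field vec \<Rightarrow> 'k)"
proof (rule degree_le_add)
  show "degree_le 3 q (\<lambda>v :: 'k vec. v $ 2 * v $ 0 ^ (q - 1))"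
    by (rule degree_le_monomial[of _ _ 1 "(!) [q - 1, 0, 1]"])
      (use assms in \<open>auto simp: numeral_3_eq_3 numeral_2_eq_2 lessThan_Suc\<close>)
  show "degree_le 3 q (\<lambda>v :: 'k vec. - (v $ 1 ^ q))"
    by (rule degree_le_monomial[of _ _ "-1" "(!) [0, q, 0]"])
      (auto simp: numeral_3_eq_3 lessThan_Suc)
qed (auto simp: inv_u_def coord_def)

lemma sigma_set_rep_V:
  assumes "prime CHAR('k::alg_closed_field)" "p = CHAR('k)" "n \<ge> 1"
  shows "sigma_set additive_group 3 (rep_V p n)
    (invariants_le additive_group 3 (rep_V p n :: 'k \<Rightarrow> 'k mat) (p ^ n))"
  unfolding sigma_set_def
proof (intro conjI ballI)
  let ?I = "invariants_le additive_group 3 (rep_V p n :: 'k \<Rightarrow> 'k mat) (p ^ n)"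
  have q: "p ^ n > 1"
    using assms prime_gt_1_nat by (intro one_less_power) auto
  have p: "p > 0"
    using assms(1,2) prime_gt_0_nat by auto
  fix v :: "'k vec"
  assume v: "v \<in> carrier_vec 3 - nullcone additive_group 3 (rep_V p n)"
  then obtain a b c where abc: "v = vec3 a b c"
    by (auto elim: vec3_cases)
  obtain f where f: "f \<in> invariant_ring additive_group 3 (rep_V p n)" "f (0\<^sub>v 3) = 0" "f v \<noteq> 0"
    using v by (auto simp: nullcone_def plus_part_def)
  obtain h where h: "\<And>a b c. f (vec3 a b c) = poly2 h a (c * a ^ (p ^ n - 1) - b ^ (p ^ n))"
    using poly2_form_of_invariant[OF f(1) q] by blast
  have "poly2 h 0 0 = 0"
    using f(2) h[of 0 0 0] p q by (simp add: zero_vec3 power_0_left)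
  then have "coord 3 0 v \<noteq> 0 \<or> inv_u (p ^ n) v \<noteq> 0"
    using f(3) by (auto simp: abc h)
  moreover have "coord 3 0 \<in> plus_part 3 ?I"
    using p q by (simp add: plus_part_def invariants_le_def coord0_invariant degree_le_coord zero_vec3)
  moreover have "inv_u (p ^ n) \<in> plus_part 3 ?I"
    using p q by (simp add: plus_part_def invariants_le_def inv_u_invariant[OF assms(1,2)]
        degree_le_inv_u zero_vec3 power_0_left)
  ultimately show "\<exists>f\<in>plus_part 3 ?I. f v \<noteq> 0" by blast
qed (auto simp: invariants_le_def)

lemma degree_bound_if_delta_set_rep_V:
  assumes "prime CHAR('k::alg_closed_field)" "p = CHAR('k)" "n \<ge> 1"
    and "delta_set additive_group 3 (rep_V p n)
      (invariants_le additive_group 3 (rep_V p n :: 'k \<Rightarrow> 'k mat) d)"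
  shows "p ^ n \<le> d"
proof (rule ccontr)
  assume d: "\<not> p ^ n \<le> d"
  let ?w = "vec3 0 1 0 :: 'k vec"
  have q: "p ^ n > 1"
    using assms prime_gt_1_nat by (intro one_less_power) auto
  have p: "p > 0"
    using assms(1,2) prime_gt_0_nat by auto
  have "inv_u (p ^ n) \<in> plus_part 3 (invariant_ring additive_group 3 (rep_V p n :: 'k \<Rightarrow> 'k mat))"
    using p q by (simp add: plus_part_def inv_u_invariant[OF assms(1,2)] zero_vec3 power_0_left)
  moreover have "inv_u (p ^ n) ?w \<noteq> 0"
    using p q by simp
  ultimately have "?w \<notin> nullcone additive_group 3 (rep_V p n)"
    unfolding nullcone_def by blast
  moreover have "?w \<in> fixed_points additive_group 3 (rep_V p n)"
    by (simp add: fixed_points_def rep_V_vec3)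
  ultimately obtain f where
    "f \<in> plus_part 3 (invariants_le additive_group 3 (rep_V p n :: 'k \<Rightarrow> 'k mat) d)"
    and fw: "f ?w \<noteq> 0"
    using assms(4) unfolding delta_set_def by blast
  then have f: "f \<in> invariant_ring additive_group 3 (rep_V p n)" "degree_le 3 d f" "f (0\<^sub>v 3) = 0"
    by (auto simp: plus_part_def invariants_le_def)
  obtain h where h: "\<And>a b c. f (vec3 a b c) = poly2 h a (c * a ^ (p ^ n - 1) - b ^ (p ^ n))"
    using poly2_form_of_invariant[OF f(1) q] by blast
  obtain r k where rk: "h = pCons r k" by (cases h)
  obtain P where P: "degree P \<le> d" "\<And>s. f (s \<cdot>\<^sub>v ?w) = poly P s"
    using degree_le_on_line[OF f(2)] by (metis vec3_carrier)
  have "poly (pcompose r (monom (-1) (p ^ n))) s = poly P s" for s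
    using q by (simp add: smult_vec3 h rk poly_pcompose poly_monom flip: P(2))
  then have "pcompose r (monom (-1) (p ^ n)) = P"
    using poly_eqI_infinite[OF infinite_UNIV_alg_closed, of "{}"] by blast
  then have "degree r * p ^ n \<le> d"
    using P(1) by (auto simp: degree_pcompose degree_monom_eq)
  then have "degree r = 0"
    using d by (cases "degree r") auto
  then obtain c where "r = [:c:]"
    by (auto elim: degree_eq_zeroE)
  then have "f ?w = f (vec3 0 0 0)"
    by (simp add: h rk)
  then show False
    using fw f(3) by (simp add: zero_vec3)
qed

lemma delta_rep_V:
  assumes "prime CHAR('k::alg_closed_field)" "p = CHAR('k)" "n \<ge> 1"
  shows "delta additive_group 3 (rep_V p n :: 'k \<Rightarrow> 'k mat) = p ^ n"
  unfolding delta_def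
  by (intro Least_equality sigma_set_imp_delta_set[OF sigma_set_rep_V[OF assms]]
      degree_bound_if_delta_set_rep_V[OF assms])

lemma sigma_rep_V:
  assumes "prime CHAR('k::alg_closed_field)" "p = CHAR('k)" "n \<ge> 1"
  shows "sigma additive_group 3 (rep_V p n :: 'k \<Rightarrow> 'k mat) = p ^ n"
  unfolding sigma_def
  by (intro Least_equality sigma_set_rep_V[OF assms]
      degree_bound_if_delta_set_rep_V[OF assms] sigma_set_imp_delta_set)

lemma enat_eq_infinityI:
  assumes "\<And>m. enat m < x"
  shows "x = \<infinity>"
  using assms by (cases x) auto

theorem proposition4p4:
  fixes p :: nat
  assumes "CHAR('k::alg_closed_field) = p" and "p > 0"
  shows "(\<forall>n\<ge>1.
            rational_rep additive_group 3 (rep_V p n :: 'k \<Rightarrow> 'k mat) \<and>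
            invariant_ring additive_group 3 (rep_V p n :: 'k \<Rightarrow> 'k mat) =
              generated_algebra (carrier_vec 3)
                {coord 3 0,
                 \<lambda>v\<in>carrier_vec 3.
                   coord 3 2 v * coord 3 0 v ^ (p ^ n - 1) - coord 3 1 v ^ (p ^ n)} \<and>
            delta additive_group 3 (rep_V p n :: 'k \<Rightarrow> 'k mat) = p ^ n \<and>
            sigma additive_group 3 (rep_V p n :: 'k \<Rightarrow> 'k mat) = p ^ n) \<and>
         delta_group (additive_group :: ('k, 'k) alg_group) = \<infinity> \<and>
         sigma_group (additive_group :: ('k, 'k) alg_group) = \<infinity>"
proof -
  have prime: "prime CHAR('k)" and p: "p = CHAR('k)"
    using assms prime_CHAR_semidom[where ?'a = 'k] by auto
  have rep: "rational_rep additive_group 3 (rep_V p n :: 'k \<Rightarrow> 'k mat)" for n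
    by (rule rational_rep_V[OF prime p])
  have less: "m < p ^ Suc m" for m
    using prime_gt_1_nat[OF prime] p power_gt_expt[of p "Suc m"] by simp
  have "delta_group (additive_group :: ('k, 'k) alg_group) = \<infinity>"
  proof (rule enat_eq_infinityI)
    fix m
    have "enat m < enat (delta additive_group 3 (rep_V p (Suc m) :: 'k \<Rightarrow> 'k mat))"
      using less[of m] by (simp add: delta_rep_V[OF prime p])
    also have "\<dots> \<le> delta_group (additive_group :: ('k, 'k) alg_group)"
      unfolding delta_group_def using rep by (intro SUP_upper2[of "(3, rep_V p (Suc m))"]) auto
    finally show "enat m < delta_group (additive_group :: ('k, 'k) alg_group)" .
  qed
  moreover have "sigma_group (additive_group :: ('k, 'k) alg_group) = \<infinity>"
  proof (rule enat_eq_infinityI)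
    fix m
    have "enat m < enat (sigma additive_group 3 (rep_V p (Suc m) :: 'k \<Rightarrow> 'k mat))"
      using less[of m] by (simp add: sigma_rep_V[OF prime p])
    also have "\<dots> \<le> sigma_group (additive_group :: ('k, 'k) alg_group)"
      unfolding sigma_group_def using rep by (intro SUP_upper2[of "(3, rep_V p (Suc m))"]) auto
    finally show "enat m < sigma_group (additive_group :: ('k, 'k) alg_group)" .
  qed
  ultimately show ?thesis
    using rep invariant_ring_rep_V[OF prime p] delta_rep_V[OF prime p] sigma_rep_V[OF prime p]
    unfolding inv_u_def by blast
qed

end
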